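(* Let $A=(\Sigma,G,\mathcal I)$ and $A'=(\Sigma',G',\mathcal I')$ be proto-algorithms with $\mathcal I=(D,D_{in},D_{out},I)$ and $\mathcal I'=(D',D'_{in},D'_{out},I')$. If $A\sqsubseteq_a A'$, then there exist total functions $h_{in}:D_{in}\to D'_{in}$ and $h_{out}:D'_{out}\to D_{out}$ such that: (1) for all $d\in D_{in}$, if $\widehat A(d)$ is defined then $\widehat{A'}(h_{in}(d))$ is defined; (2) for all $d\in D_{in}$ and $d'\in D_{out}$, if $\widehat A(d)=d'$ then $h_{out}(\widehat{A'}(h_{in}(d)))=d'$; (3) for all $d\in D_{in}$ such that $\widehat A(d)$ is defined, $\mathrm{nas}(A,d)=\mathrm{nas}(A',h_{in}(d))$.
   Context: An alphabet is a pair $\Sigma=(F,P)$ of disjoint countable sets with distinguished $\mathsf{ini},\mathsf{fin}\in F$; $\widetilde F=F\setminus\{\mathsf{ini},\mathsf{fin}\}$. A rooted labeled directed graph is $(V,E,L_v,L_e,l,r)$ with $V$ nonempty finite, $E\subseteq V\times V$, $L_v,L_e$ countable, $l$ a partial function from $V\cup E$ to $L_v\cup L_e$ mapping vertices into $L_v$ and edges into $L_e$, $r\in V$; indegree/outdegree are numbers of in/out-neighbours; a cycle is $v_1\ldots v_{n+1}$ with $(v_i,v_{i+1})\in E$, $v_1,\dots,v_n$ distinct, $v_1=v_{n+1}$. A $\Sigma$-algorithm graph is such a graph with $L_v=F\cup P$, $L_e=\{0,1\}$, such that for every vertex $v$: $l(v)=\mathsf{ini}$ iff $v=r$; if $l(v)=\mathsf{ini}$: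 indegree $0$, outdegree $1$, outgoing edge unlabeled; if $l(v)=\mathsf{fin}$: indegree $>0$, outdegree $0$; if $l(v)\in\widetilde F$: indegree $>0$, outdegree $1$, outgoing edge unlabeled; if $l(v)\in P$: indegree $>0$, outdegree $2$, both outgoing edges labeled with different labels; and every cycle contains a vertex labeled by an element of $F$. A $\Sigma$-interpretation is $(D,D_{in},D_{out},I)$ with total computable $I(\mathsf{ini}):D_{in}\to D$, $I(\mathsf{fin}):D\to D_{out}$, $I(f):D\to D$ ($f\in\widetilde F$), $I(p):D\to\{0,1\}$ ($p\in P$), such that no proper subset of $D$ contains $I(\mathsf{ini})(D_{in})$ and is closed under all $I(f)$, $f\in\widetilde F$. A proto-algorithm is $A=(\Sigma,G,\mathcal I)$ with $G$ a $\Sigma$-algorithm graph $(V,E,L_v,L_e,l,r)$ and $\mathcal I$ a $\Sigma$-interpretation. The algorithmic step function $\mathrm{astep}_A$ on $D_{in}\cup(V\times D)\cup D_{out}$: $\mathrm{astep}_A(d)=(v',I(\mathsf{ini})(d))$ for $d\in D_{in}$, $(r,v')\in E$; $\mathrm{astep}_A((v,d))=(v',I(o)(d))$ if $l(v)=o\in\widetilde F$, $(v,v')\in E$; $\mathrm{astep}_A((v,d))=(v',d)$ if $l(v)=p\in P$, $(v,v')\in E$, $I(p)(d)=l((v,v'))$; $\mathrm{astep}_A((v,d))=I(\mathsf{fin})(d)$ if $l(v)=\mathsf{fin}$; $\mathrm{astep}_A(d)=d$ for $d\in D_{out}$. $\mathrm{astep}^n_A$ denotes its $n$-fold iterate ($\mathrm{astep}^0_A=\mathrm{id}$).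 An algorithmic simulation of $A$ by $A'$ is $R\subseteq (D_{in}\times D'_{in})\cup((V\times D)\times(V'\times D'))\cup(D_{out}\times D'_{out})$ such that every $d\in D_{in}$ is related to a unique $d'\in D'_{in}$, every $d'\in D'_{out}$ is related to a unique $d\in D_{out}$ (i.e. there is a unique $d$ with $(d,d')\in R$), and $(d,d')\in R$ implies $(\mathrm{astep}_A(d),\mathrm{astep}_{A'}(d'))\in R$. $A\sqsubseteq_a A'$ means such an $R$ exists. The function computed by $A$ is the partial function $\widehat A:D_{in}\to D_{out}$, $\widehat A(d)=\mathrm{astep}^*_A(d)$, where $\mathrm{astep}^*_A$ is the least-defined partial function on $D_{in}\cup(V\times D)\cup D_{out}$ with $\mathrm{astep}^*_A(d)=\mathrm{astep}^*_A(\mathrm{astep}_A(d))$ if $\mathrm{astep}_A(d)\in V\times D$ and $\mathrm{astep}^*_A(d)=\mathrm{astep}_A(d)$ if $\mathrm{astep}_A(d)\in D_{out}$. For $d\in D_{in}$ with $\widehat A(d)$ defined, $\mathrm{nas}(A,d)$ is the least $n\in\mathbb N$ with $\mathrm{astep}^n_A(d)=\widehat A(d)$. *)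

theory Defs
  imports "HOL-Library.Countable_Set" "HOL-Library.FuncSet"
begin

section \<open>Computable functions\<close>

text \<open>Partial recursive functions, given by a big-step semantics; \<open>reval e xs y\<close> means that
  \<open>e\<close> halts on the argument tuple \<open>xs\<close> with result \<open>y\<close>. The recursion argument of \<open>Prec\<close> and the
  search variable of \<open>Mu\<close> come first.\<close>

datatype recf = Zero | Succ | Proj nat | Comp recf "recf list" | Prec recf recf | Mu recf

inductive reval :: "recf \<Rightarrow> nat list \<Rightarrow> nat \<Rightarrow> bool" where
  reval_Zero: "reval Zero xs 0"
| reval_Succ: "reval Succ (x # xs) (Suc x)"
| reval_Proj: "i < length xs \<Longrightarrow> reval (Proj i) xs (xs ! i)"
| reval_Comp: "list_all2 (\<lambda>g y. reval g xs y) gs ys \<Longrightarrow> reval f ys z \<Longrightarrow> reval (Comp f gs) xs z"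
| reval_Prec_0: "reval f xs y \<Longrightarrow> reval (Prec f g) (0 # xs) y"
| reval_Prec_Suc: "reval (Prec f g) (n # xs) y \<Longrightarrow> reval g (n # y # xs) z
    \<Longrightarrow> reval (Prec f g) (Suc n # xs) z"
| reval_Mu: "reval f (n # xs) 0 \<Longrightarrow> (\<forall>m<n. \<exists>y. reval f (m # xs) (Suc y))
    \<Longrightarrow> reval (Mu f) xs n"

inductive_cases reval_ZeroE: "reval Zero xs y"
inductive_cases reval_SuccE: "reval Succ xs y"
inductive_cases reval_ProjE: "reval (Proj i) xs y"
inductive_cases reval_CompE: "reval (Comp f gs) xs y"
inductive_cases reval_Prec_0E: "reval (Prec f g) (0 # xs) y"
inductive_cases reval_Prec_SucE: "reval (Prec f g) (Suc n # xs) y"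
inductive_cases reval_MuE: "reval (Mu f) xs y"

lemma reval_deterministic: "reval e xs y \<Longrightarrow> reval e xs y' \<Longrightarrow> y = y'"
proof (induction arbitrary: y' rule: reval.induct)
  case (reval_Zero xs)
  then show ?case by (rule reval_ZeroE) simp
next
  case (reval_Succ x xs)
  then show ?case by (rule reval_SuccE) simp
next
  case (reval_Proj i xs)
  from reval_Proj.prems show ?case by (rule reval_ProjE) simp
next
  case (reval_Comp xs gs ys f z)
  from reval_Comp.prems obtain ys' where
    ys': "list_all2 (\<lambda>g y. reval g xs y) gs ys'" "reval f ys' y'"
    by (rule reval_CompE)
  have "ys = ys'"
  proof (rule nth_equalityI)
    show "length ys = length ys'"
      using list_all2_lengthD[OF reval_Comp.IH(1)] list_all2_lengthD[OF ys'(1)] by (rule subst)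
    show "ys ! i = ys' ! i" if "i < length ys" for i
    proof -
      have i: "i < length gs" using list_all2_lengthD[OF reval_Comp.IH(1)] that by (rule ssubst)
      from list_all2_nthD[OF ys'(1) i] list_all2_nthD[OF reval_Comp.IH(1) i]
      show ?thesis by blast
    qed
  qed
  with ys'(2) reval_Comp.IH(2) show ?case by blast
next
  case (reval_Prec_0 f xs y g)
  from reval_Prec_0.prems have "reval f xs y'" by (rule reval_Prec_0E)
  then show ?case by (rule reval_Prec_0.IH)
next
  case (reval_Prec_Suc f g n xs y z)
  from reval_Prec_Suc.prems obtain w where
    w: "reval (Prec f g) (n # xs) w" "reval g (n # w # xs) y'"
    by (rule reval_Prec_SucE)
  from reval_Prec_Suc.IH(1)[OF w(1)] w(2) have "reval g (n # y # xs) y'" by simp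
  then show ?case by (rule reval_Prec_Suc.IH(2))
next
  case (reval_Mu f n xs)
  from reval_Mu.prems have y': "reval f (y' # xs) 0" "\<forall>m<y'. \<exists>y. reval f (m # xs) (Suc y)"
    by (auto elim: reval_MuE)
  have "\<not> n < y'"
  proof
    assume "n < y'"
    with y'(2) obtain y where "reval f (n # xs) (Suc y)" by blast
    from reval_Mu.IH(1)[OF this] show False by simp
  qed
  moreover have "\<not> y' < n"
  proof
    assume "y' < n"
    with reval_Mu.IH(2) obtain y where "\<forall>z. reval f (y' # xs) z \<longrightarrow> Suc y = z" by blast
    with y'(1) have "Suc y = 0" by blast
    then show False by simp
  qed
  ultimately show ?case by simp
qed

text \<open>A map on \<open>A\<close> is computable relative to the numberings \<open>a\<close> of its domain and \<open>b\<close> of its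
  codomain if some partial recursive function takes codes of arguments to codes of values.\<close>

definition computable_wrt :: "('a \<Rightarrow> nat) \<Rightarrow> ('b \<Rightarrow> nat) \<Rightarrow> 'a set \<Rightarrow> ('a \<Rightarrow> 'b) \<Rightarrow> bool" where
  "computable_wrt a b A f \<longleftrightarrow> (\<exists>e. \<forall>x\<in>A. reval e [a x] (b (f x)))"


section \<open>Alphabets\<close>

record 's alphabet =
  fsyms :: "'s set"
  psyms :: "'s set"
  ini :: 's
  fin :: 's

definition alphabet :: "'s alphabet \<Rightarrow> bool" where
  "alphabet \<Sigma> \<longleftrightarrow> countable (fsyms \<Sigma>) \<and> countable (psyms \<Sigma>) \<and> fsyms \<Sigma> \<inter> psyms \<Sigma> = {} \<and>
     ini \<Sigma> \<in> fsyms \<Sigma> \<and> fin \<Sigma> \<in> fsyms \<Sigma> \<and> ini \<Sigma> \<noteq> fin \<Sigma>"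

definition inner_fsyms :: "'s alphabet \<Rightarrow> 's set" where
  "inner_fsyms \<Sigma> = fsyms \<Sigma> - {ini \<Sigma>, fin \<Sigma>}"


section \<open>Algorithm graphs\<close>

text \<open>The partial labeling function on vertices and edges is split into its restriction to the
  vertices and its restriction to the edges.\<close>

record ('v, 'lv, 'le) lgraph =
  verts :: "'v set"
  edges :: "('v \<times> 'v) set"
  vlabels :: "'lv set"
  elabels :: "'le set"
  vlab :: "'v \<Rightarrow> 'lv option"
  elab :: "'v \<times> 'v \<Rightarrow> 'le option"
  root :: 'v

definition rooted_labeled_digraph :: "('v, 'lv, 'le) lgraph \<Rightarrow> bool" where
  "rooted_labeled_digraph G \<longleftrightarrow>
     finite (verts G) \<and> verts G \<noteq> {} \<and> edges G \<subseteq> verts G \<times> verts G \<and>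
     countable (vlabels G) \<and> countable (elabels G) \<and>
     dom (vlab G) \<subseteq> verts G \<and> ran (vlab G) \<subseteq> vlabels G \<and>
     dom (elab G) \<subseteq> edges G \<and> ran (elab G) \<subseteq> elabels G \<and>
     root G \<in> verts G"

definition in_nbs :: "('v, 'lv, 'le) lgraph \<Rightarrow> 'v \<Rightarrow> 'v set" where
  "in_nbs G v = {u. (u, v) \<in> edges G}"

definition out_nbs :: "('v, 'lv, 'le) lgraph \<Rightarrow> 'v \<Rightarrow> 'v set" where
  "out_nbs G v = {w. (v, w) \<in> edges G}"

definition indegree :: "('v, 'lv, 'le) lgraph \<Rightarrow> 'v \<Rightarrow> nat" where
  "indegree G v = card (in_nbs G v)"

definition outdegree :: "('v, 'lv, 'le) lgraph \<Rightarrow> 'v \<Rightarrow> nat" where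
  "outdegree G v = card (out_nbs G v)"

text \<open>A cycle has at least one edge; a loop is a cycle.\<close>

definition is_cycle :: "('v, 'lv, 'le) lgraph \<Rightarrow> 'v list \<Rightarrow> bool" where
  "is_cycle G vs \<longleftrightarrow> length vs \<ge> 2 \<and> successively (\<lambda>u w. (u, w) \<in> edges G) vs \<and>
     distinct (butlast vs) \<and> hd vs = last vs"

text \<open>The edge labels 0 and 1 are rendered as \<open>False\<close> and \<open>True\<close>.\<close>

definition algorithm_graph :: "'s alphabet \<Rightarrow> ('v, 's, bool) lgraph \<Rightarrow> bool" where
  "algorithm_graph \<Sigma> G \<longleftrightarrow>
     rooted_labeled_digraph G \<and>
     vlabels G = fsyms \<Sigma> \<union> psyms \<Sigma> \<and> elabels G = {False, True} \<and>
     (\<forall>v\<in>verts G.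
        (vlab G v = Some (ini \<Sigma>) \<longleftrightarrow> v = root G) \<and>
        (vlab G v = Some (ini \<Sigma>) \<longrightarrow>
           indegree G v = 0 \<and> outdegree G v = 1 \<and> (\<forall>w\<in>out_nbs G v. elab G (v, w) = None)) \<and>
        (vlab G v = Some (fin \<Sigma>) \<longrightarrow> indegree G v > 0 \<and> outdegree G v = 0) \<and>
        (\<forall>f\<in>inner_fsyms \<Sigma>. vlab G v = Some f \<longrightarrow>
           indegree G v > 0 \<and> outdegree G v = 1 \<and> (\<forall>w\<in>out_nbs G v. elab G (v, w) = None)) \<and>
        (\<forall>p\<in>psyms \<Sigma>. vlab G v = Some p \<longrightarrow>
           indegree G v > 0 \<and> outdegree G v = 2 \<and>
           (\<forall>w\<in>out_nbs G v. elab G (v, w) \<noteq> None) \<and>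
           inj_on (\<lambda>w. elab G (v, w)) (out_nbs G v))) \<and>
     (\<forall>vs. is_cycle G vs \<longrightarrow> (\<exists>v\<in>set vs. \<exists>f\<in>fsyms \<Sigma>. vlab G v = Some f))"


section \<open>Interpretations\<close>

text \<open>The interpretations of the four kinds of symbols have different types and are therefore
  separate components.\<close>

record ('s, 'd, 'i, 'o) interp =
  mdom :: "'d set"
  indom :: "'i set"
  outdom :: "'o set"
  I_ini :: "'i \<Rightarrow> 'd"
  I_fin :: "'d \<Rightarrow> 'o"
  I_fun :: "'s \<Rightarrow> 'd \<Rightarrow> 'd"
  I_pred :: "'s \<Rightarrow> 'd \<Rightarrow> bool"

text \<open>Abstract sets carry no canonical notion of computability. The interpreting functions are
  required to be computable relative to some injective numberings of the three domains, the same
  ones for all symbols.\<close>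

definition computable_interp :: "'s alphabet \<Rightarrow> ('s, 'd, 'i, 'o) interp \<Rightarrow> bool" where
  "computable_interp \<Sigma> J \<longleftrightarrow> (\<exists>cd ci co.
     inj_on cd (mdom J) \<and> inj_on ci (indom J) \<and> inj_on co (outdom J) \<and>
     computable_wrt ci cd (indom J) (I_ini J) \<and>
     computable_wrt cd co (mdom J) (I_fin J) \<and>
     (\<forall>f\<in>inner_fsyms \<Sigma>. computable_wrt cd cd (mdom J) (I_fun J f)) \<and>
     (\<forall>p\<in>psyms \<Sigma>. computable_wrt cd of_bool (mdom J) (I_pred J p)))"

definition interpretation_of :: "'s alphabet \<Rightarrow> ('s, 'd, 'i, 'o) interp \<Rightarrow> bool" where
  "interpretation_of \<Sigma> J \<longleftrightarrow>
     I_ini J \<in> indom J \<rightarrow> mdom J \<and>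
     I_fin J \<in> mdom J \<rightarrow> outdom J \<and>
     (\<forall>f\<in>inner_fsyms \<Sigma>. I_fun J f \<in> mdom J \<rightarrow> mdom J) \<and>
     computable_interp \<Sigma> J \<and>
     \<not> (\<exists>S. S \<subset> mdom J \<and> I_ini J ` indom J \<subseteq> S \<and>
            (\<forall>f\<in>inner_fsyms \<Sigma>. I_fun J f ` S \<subseteq> S))"


section \<open>Proto-algorithms and their step function\<close>

record ('s, 'v, 'd, 'i, 'o) proto_alg =
  alph :: "'s alphabet"
  graph :: "('v, 's, bool) lgraph"
  interp :: "('s, 'd, 'i, 'o) interp"

definition proto_algorithm :: "('s, 'v, 'd, 'i, 'o) proto_alg \<Rightarrow> bool" where
  "proto_algorithm A \<longleftrightarrow> alphabet (alph A) \<and> algorithm_graph (alph A) (graph A) \<and>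
     interpretation_of (alph A) (interp A)"

abbreviation D_main :: "('s, 'v, 'd, 'i, 'o) proto_alg \<Rightarrow> 'd set" where
  "D_main A \<equiv> mdom (interp A)"

abbreviation D_in :: "('s, 'v, 'd, 'i, 'o) proto_alg \<Rightarrow> 'i set" where
  "D_in A \<equiv> indom (interp A)"

abbreviation D_out :: "('s, 'v, 'd, 'i, 'o) proto_alg \<Rightarrow> 'o set" where
  "D_out A \<equiv> outdom (interp A)"

text \<open>States are tagged, so that the union of the input domain, the vertex-data pairs and the output
  domain is disjoint.\<close>

datatype ('v, 'd, 'i, 'o) state = Inp 'i | Mid 'v 'd | Out 'o

definition states :: "('s, 'v, 'd, 'i, 'o) proto_alg \<Rightarrow> ('v, 'd, 'i, 'o) state set" where
  "states A = Inp ` D_in A \<union> {Mid v d |v d. v \<in> verts (graph A) \<and> d \<in> D_main A} \<union> Out ` D_out A"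

text \<open>The step function is undefined where no defining clause applies, for example at \<open>Mid v d\<close> when
  \<open>v\<close> is the root. In an algorithm graph the vertices selected by \<open>THE\<close> exist and are unique.\<close>

fun astep_raw :: "('s, 'v, 'd, 'i, 'o) proto_alg \<Rightarrow> ('v, 'd, 'i, 'o) state
    \<Rightarrow> ('v, 'd, 'i, 'o) state option" where
  "astep_raw A (Inp d) =
     Some (Mid (THE v'. (root (graph A), v') \<in> edges (graph A)) (I_ini (interp A) d))"
| "astep_raw A (Mid v d) =
     (case vlab (graph A) v of
        None \<Rightarrow> None
      | Some q \<Rightarrow>
          if q \<in> inner_fsyms (alph A) then
            Some (Mid (THE v'. (v, v') \<in> edges (graph A)) (I_fun (interp A) q d))
          else if q \<in> psyms (alph A) then
            Some (Mid (THE v'. (v, v') \<in> edges (graph A) \<and>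
                               elab (graph A) (v, v') = Some (I_pred (interp A) q d)) d)
          else if q = fin (alph A) then Some (Out (I_fin (interp A) d))
          else None)"
| "astep_raw A (Out d) = Some (Out d)"

definition astep :: "('s, 'v, 'd, 'i, 'o) proto_alg \<Rightarrow> ('v, 'd, 'i, 'o) state
    \<Rightarrow> ('v, 'd, 'i, 'o) state option" where
  "astep A c = (if c \<in> states A then astep_raw A c else None)"

primrec astep_pow :: "('s, 'v, 'd, 'i, 'o) proto_alg \<Rightarrow> nat \<Rightarrow> ('v, 'd, 'i, 'o) state
    \<Rightarrow> ('v, 'd, 'i, 'o) state option" where
  "astep_pow A 0 c = Some c"
| "astep_pow A (Suc n) c = Option.bind (astep_pow A n c) (astep A)"


section \<open>Algorithmic simulation\<close>

text \<open>The step condition imposes nothing on pairs whose first component has no successor; if the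
  first component has one, so must the second.\<close>

definition algorithmic_simulation ::
  "('s, 'v, 'd, 'i, 'o) proto_alg \<Rightarrow> ('t, 'w, 'e, 'j, 'p) proto_alg
    \<Rightarrow> (('v, 'd, 'i, 'o) state \<times> ('w, 'e, 'j, 'p) state) set \<Rightarrow> bool" where
  "algorithmic_simulation A A' R \<longleftrightarrow>
     R \<subseteq> {(Inp d, Inp d') |d d'. d \<in> D_in A \<and> d' \<in> D_in A'} \<union>
         {(Mid v d, Mid v' d') |v d v' d'. v \<in> verts (graph A) \<and> d \<in> D_main A \<and>
                                           v' \<in> verts (graph A') \<and> d' \<in> D_main A'} \<union>
         {(Out d, Out d') |d d'. d \<in> D_out A \<and> d' \<in> D_out A'} \<and>
     (\<forall>d\<in>D_in A. \<exists>!d'. d' \<in> D_in A' \<and> (Inp d, Inp d') \<in> R) \<and>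
     (\<forall>d'\<in>D_out A'. \<exists>!d. d \<in> D_out A \<and> (Out d, Out d') \<in> R) \<and>
     (\<forall>c c' e. (c, c') \<in> R \<and> astep A c = Some e \<longrightarrow>
        (\<exists>e'. astep A' c' = Some e' \<and> (e, e') \<in> R))"

definition alg_simulated_by ::
  "('s, 'v, 'd, 'i, 'o) proto_alg \<Rightarrow> ('t, 'w, 'e, 'j, 'p) proto_alg \<Rightarrow> bool"
  (infix "\<sqsubseteq>\<^sub>a" 50) where
  "A \<sqsubseteq>\<^sub>a A' \<longleftrightarrow> (\<exists>R. algorithmic_simulation A A' R)"


section \<open>Computed function and number of steps\<close>

text \<open>In the mode \<open>option\<close>, a recursive equation denotes its least-defined solution. The case
  \<open>Inp\<close> never arises, since no step leads back to an input.\<close>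

partial_function (option) astep_star ::
  "('s, 'v, 'd, 'i, 'o) proto_alg \<Rightarrow> ('v, 'd, 'i, 'o) state \<Rightarrow> 'o option" where
  "astep_star A c = Option.bind (astep A c)
     (\<lambda>c'. case c' of Inp d \<Rightarrow> None | Mid v d \<Rightarrow> astep_star A c' | Out d \<Rightarrow> Some d)"

definition computed :: "('s, 'v, 'd, 'i, 'o) proto_alg \<Rightarrow> 'i \<Rightarrow> 'o option" where
  "computed A d = astep_star A (Inp d)"

definition nas :: "('s, 'v, 'd, 'i, 'o) proto_alg \<Rightarrow> 'i \<Rightarrow> nat" where
  "nas A d = (LEAST n. astep_pow A n (Inp d) = Some (Out (the (computed A d))))"

end

theory Submission
  imports Defs
begin

text \<open>A simulation relates the \<open>n\<close>-th state of a run of \<open>A\<close> to the \<open>n\<close>-th state of the run of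
  \<open>A'\<close> on the corresponding input, and related states are of the same kind: input, intermediate or
  output. Hence both runs reach their outputs after the same number of steps. The uniqueness clauses
  for inputs and outputs provide \<open>h_in\<close> and \<open>h_out\<close>.\<close>

lemma astep_neq_Inp: "astep A c \<noteq> Some (Inp i)"
  by (cases c) (auto simp: astep_def split: option.splits if_splits)

lemma astep_Out: "astep A (Out x) = Some e \<Longrightarrow> e = Out x"
  by (simp add: astep_def split: if_splits)

lemma astep_pow_add: "astep_pow A (m + n) c = Option.bind (astep_pow A m c) (astep_pow A n)"
proof (induction n)
  case 0
  then show ?case by (cases "astep_pow A m c") auto
next
  case (Suc n)
  then show ?case by (cases "astep_pow A m c") auto
qed

text \<open>\<open>astep_pow\<close> adds steps at the end of a run, \<open>astep_star\<close> peels
  them off at the front; this bridges the two recursions.\<close>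

lemma astep_pow_Suc_left: "astep_pow A (Suc n) c = Option.bind (astep A c) (astep_pow A n)"
  using astep_pow_add[of A 1 n c] by simp

lemma astep_pow_Out: "astep_pow A n (Out x) = Some e \<Longrightarrow> e = Out x"
proof (induction n arbitrary: e)
  case (Suc n)
  from Suc.prems obtain e' where e': "astep_pow A n (Out x) = Some e'" "astep A e' = Some e"
    by (auto simp: bind_eq_Some_conv)
  with Suc.IH astep_Out show ?case by metis
qed simp

text \<open>Membership in \<open>D_out A\<close> makes \<open>Out x\<close> a state; outside
  \<open>states A\<close> the step is undefined rather than the identity.\<close>

lemma astep_pow_Out_D_out: "x \<in> D_out A \<Longrightarrow> astep_pow A n (Out x) = Some (Out x)"
  by (induction n) (auto simp: astep_def states_def)

text \<open>The exponent is a successor because \<open>astep_star\<close> takes a step before it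
  looks for an output.\<close>

lemma astep_star_SomeD:
  "astep_star A c = Some x \<Longrightarrow> \<exists>n. astep_pow A (Suc n) c = Some (Out x)"
\<comment> \<open>Fixpoint induction: the function \<open>f\<close> in the induction step is an
  arbitrary function that already satisfies the claim, standing for the recursive call.\<close>
proof (induction rule: astep_star.raw_induct[rotated, consumes 1, case_names step])
  case (step f A c x)
  from step.hyps obtain e where e: "astep A c = Some e"
    and x: "(case e of Inp d \<Rightarrow> None | Mid v d \<Rightarrow> f A e | Out d \<Rightarrow> Some d) = Some x"
    by (auto simp: bind_eq_Some_conv)
  show ?case
  proof (cases e)
    case (Inp i)
    with x show ?thesis by simp
  next
    case (Mid v d)
    with x have "f A e = Some x" by simp
    then obtain n where "astep_pow A (Suc n) e = Some (Out x)" using step.IH by blast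
    then have "astep_pow A (Suc (Suc n)) c = Some (Out x)"
      using e by (subst astep_pow_Suc_left) (simp del: astep_pow.simps)
    then show ?thesis ..
  next
    case (Out y)
    with x e have "astep_pow A (Suc 0) c = Some (Out x)" by simp
    then show ?thesis ..
  qed
qed

lemma astep_star_SomeI:
  "astep_pow A (Suc n) c = Some (Out x) \<Longrightarrow> astep_star A c = Some x"
proof (induction n arbitrary: c)
  case 0
  then show ?case by (subst astep_star.simps) simp
next
  case (Suc n)
  then obtain e where e: "astep A c = Some e" "astep_pow A (Suc n) e = Some (Out x)"
    by (subst (asm) astep_pow_Suc_left) (auto simp: bind_eq_Some_conv simp del: astep_pow.simps)
  show ?case
  proof (cases e)
    case (Inp i)
    with e(1) show ?thesis by (simp add: astep_neq_Inp)
  next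
    case (Mid v d)
    with e Suc.IH show ?thesis by (subst astep_star.simps) simp
  next
    case (Out y)
    \<comment> \<open>The output appears before the last step, and further steps cannot change
      it.\<close>
    with astep_pow_Out[of A "Suc n" y] e(2) have "x = y" by auto
    with e(1) Out show ?thesis by (subst astep_star.simps) simp
  qed
qed

text \<open>Besides linking \<open>computed\<close> to runs, this shows that all outputs reached
  from one input coincide, whatever the step count.\<close>

lemma computed_eq_Some_iff:
  "computed A d = Some x \<longleftrightarrow> (\<exists>n. astep_pow A n (Inp d) = Some (Out x))"
proof
  assume "computed A d = Some x"
  then show "\<exists>n. astep_pow A n (Inp d) = Some (Out x)"
    unfolding computed_def by (blast dest: astep_star_SomeD)
next
  assume "\<exists>n. astep_pow A n (Inp d) = Some (Out x)"
  then obtain n where n: "astep_pow A n (Inp d) = Some (Out x)" ..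
  then obtain k where "n = Suc k" by (cases n) auto
  with n show "computed A d = Some x"
    unfolding computed_def using astep_star_SomeI[of A k] by auto
qed

lemma algorithmic_simulation_astep_pow:
  assumes "algorithmic_simulation A A' R" and "(c, c') \<in> R" and "astep_pow A n c = Some e"
  shows "\<exists>e'. astep_pow A' n c' = Some e' \<and> (e, e') \<in> R"
  using assms(3)
proof (induction n arbitrary: e)
  case 0
  with assms(2) show ?case by simp
next
  case (Suc n)
  then obtain f where f: "astep_pow A n c = Some f" "astep A f = Some e"
    by (auto simp: bind_eq_Some_conv)
  from Suc.IH[OF f(1)] obtain f' where f': "astep_pow A' n c' = Some f'" "(f, f') \<in> R" by blast
  have "\<exists>e'. astep A' f' = Some e' \<and> (e, e') \<in> R"
    using assms(1) f'(2) f(2) unfolding algorithmic_simulation_def by blast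
  with f'(1) show ?case by simp
qed

lemma algorithmic_simulation_Out_left:
  assumes "algorithmic_simulation A A' R" and "(Out x, c) \<in> R"
  obtains x' where "c = Out x'" and "x \<in> D_out A" and "x' \<in> D_out A'"
  using assms unfolding algorithmic_simulation_def by blast

lemma algorithmic_simulation_Out_right:
  assumes "algorithmic_simulation A A' R" and "(c, Out x') \<in> R"
  obtains x where "c = Out x"
  using assms unfolding algorithmic_simulation_def by blast

lemma algorithmic_simulation_computed:
  assumes sim: "algorithmic_simulation A A' R" and R: "(Inp d, Inp d') \<in> R"
    and comp: "computed A d = Some x"
  obtains x' where "computed A' d' = Some x'" and "(Out x, Out x') \<in> R" and "x' \<in> D_out A'"
    and "nas A d = nas A' d'"
proof -
  obtain m where m: "astep_pow A m (Inp d) = Some (Out x)"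
    using comp computed_eq_Some_iff by metis
  obtain c where c: "astep_pow A' m (Inp d') = Some c" "(Out x, c) \<in> R"
    using algorithmic_simulation_astep_pow[OF sim R m] by blast
  obtain x' where x': "c = Out x'" "x \<in> D_out A" "x' \<in> D_out A'"
    using algorithmic_simulation_Out_left[OF sim c(2)] .
  have comp': "computed A' d' = Some x'"
    using c(1) x'(1) computed_eq_Some_iff by metis
  have same_time: "astep_pow A n (Inp d) = Some (Out x) \<longleftrightarrow> astep_pow A' n (Inp d') = Some (Out x')" for n
  proof -
    \<comment> \<open>The simulation carries definedness only from \<open>A\<close> to
      \<open>A'\<close>, so the run of \<open>A\<close> must be defined at every \<open>n\<close>.
      It stays at its output after step \<open>m\<close>, hence is defined at \<open>m + n\<close>,
      and so is its prefix of length \<open>n\<close>.\<close>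
    have "astep_pow A (m + n) (Inp d) = Some (Out x)"
      by (simp add: astep_pow_add m astep_pow_Out_D_out x'(2))
    then have "Option.bind (astep_pow A n (Inp d)) (astep_pow A m) = Some (Out x)"
      using astep_pow_add[of A n m] by (simp add: add.commute)
    then obtain e where e: "astep_pow A n (Inp d) = Some e"
      by (auto simp: bind_eq_Some_conv)
    obtain e' where e': "astep_pow A' n (Inp d') = Some e'" "(e, e') \<in> R"
      using algorithmic_simulation_astep_pow[OF sim R e] by blast
    show ?thesis
    proof
      assume "astep_pow A n (Inp d) = Some (Out x)"
      with e e'(2) have "(Out x, e') \<in> R" by simp
      then obtain y where y: "e' = Out y"
        using algorithmic_simulation_Out_left[OF sim] by blast
      \<comment> \<open>\<open>R\<close> may relate \<open>Out x\<close> to several outputs of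
        \<open>A'\<close>; that \<open>y\<close> is \<open>x'\<close> follows from both being the
        computed value at \<open>d'\<close>.\<close>
      with e'(1) have "computed A' d' = Some y" using computed_eq_Some_iff by metis
      with comp' e'(1) y show "astep_pow A' n (Inp d') = Some (Out x')" by simp
    next
      assume "astep_pow A' n (Inp d') = Some (Out x')"
      with e' have "(e, Out x') \<in> R" by simp
      then obtain y where y: "e = Out y"
        using algorithmic_simulation_Out_right[OF sim] by blast
      with e have "computed A d = Some y" using computed_eq_Some_iff by metis
      with comp e y show "astep_pow A n (Inp d) = Some (Out x)" by simp
    qed
  qed
  \<comment> \<open>Both \<open>LEAST\<close> operators now range over equivalent
    predicates.\<close>
  then have "nas A d = nas A' d'"
    by (simp add: nas_def comp comp')
  with comp' c(2) x' that show thesis by blast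
qed

theorem theorem2:
  fixes A :: "('s, 'v, 'd, 'i, 'o) proto_alg"
    and A' :: "('t, 'w, 'e, 'j, 'p) proto_alg"
  assumes "proto_algorithm A"
    and "proto_algorithm A'"
    and "A \<sqsubseteq>\<^sub>a A'"
  shows "\<exists>h_in h_out. h_in \<in> D_in A \<rightarrow> D_in A' \<and> h_out \<in> D_out A' \<rightarrow> D_out A \<and>
    (\<forall>d\<in>D_in A. computed A d \<noteq> None \<longrightarrow> computed A' (h_in d) \<noteq> None) \<and>
    (\<forall>d\<in>D_in A. \<forall>d'\<in>D_out A. computed A d = Some d' \<longrightarrow>
       map_option h_out (computed A' (h_in d)) = Some d') \<and>
    (\<forall>d\<in>D_in A. computed A d \<noteq> None \<longrightarrow> nas A d = nas A' (h_in d))"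
proof -
  obtain R where sim: "algorithmic_simulation A A' R"
    using assms(3) unfolding alg_simulated_by_def by blast
  have "\<forall>d\<in>D_in A. \<exists>d'. d' \<in> D_in A' \<and> (Inp d, Inp d') \<in> R"
    using sim unfolding algorithmic_simulation_def by blast
  then obtain h_in where h_in: "\<forall>d\<in>D_in A. h_in d \<in> D_in A' \<and> (Inp d, Inp (h_in d)) \<in> R"
    by metis
  have uniq: "\<forall>d'\<in>D_out A'. \<exists>!d. d \<in> D_out A \<and> (Out d, Out d') \<in> R"
    using sim unfolding algorithmic_simulation_def by blast
  then obtain h_out where h_out: "\<forall>d'\<in>D_out A'. h_out d' \<in> D_out A \<and> (Out (h_out d'), Out d') \<in> R"
    by metis
  have main: "\<exists>x'. computed A' (h_in d) = Some x' \<and> h_out x' = x \<and> nas A d = nas A' (h_in d)"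
    if d: "d \<in> D_in A" and comp: "computed A d = Some x" for d x
  proof -
    obtain x' where x': "computed A' (h_in d) = Some x'" "(Out x, Out x') \<in> R" "x' \<in> D_out A'"
      "nas A d = nas A' (h_in d)"
      using algorithmic_simulation_computed[OF sim _ comp] h_in d by blast
    have "x \<in> D_out A"
      using algorithmic_simulation_Out_left[OF sim x'(2)] by blast
    \<comment> \<open>Both \<open>Out x\<close> and \<open>Out (h_out x')\<close> are related to
      \<open>Out x'\<close>, so the uniqueness clause for outputs identifies them.\<close>
    with uniq h_out x' have "h_out x' = x" by blast
    with x' show ?thesis by blast
  qed
  show ?thesis
  proof (intro exI conjI ballI impI)
    show "h_in \<in> D_in A \<rightarrow> D_in A'" using h_in by blast
    show "h_out \<in> D_out A' \<rightarrow> D_out A" using h_out by blast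
    show "computed A' (h_in d) \<noteq> None" if "d \<in> D_in A" "computed A d \<noteq> None" for d
      using that main by fastforce
    show "map_option h_out (computed A' (h_in d)) = Some d'"
      if "d \<in> D_in A" "computed A d = Some d'" for d d'
      using that main by fastforce
    show "nas A d = nas A' (h_in d)" if "d \<in> D_in A" "computed A d \<noteq> None" for d
      using that main by blast
  qed
qed

end
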